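(* Let $\mathscr{R}$ be the ring of entire functions in one complex variable $z$ of the form $\sum_{j=1}^n p_j\exp(q_j)$ with $n\geq 1$ and $p_j,q_j\in\mathbb{C}[z]$ for each $j$. Then the equation $$x^2-(z^2-1)y^2=1$$ in the unknowns $x,y$ has the same solutions over $\mathscr{R}$ and over $\mathbb{Z}[z]$; that is, a pair $(x,y)\in\mathscr{R}^2$ satisfies the equation if and only if $(x,y)\in\mathbb{Z}[z]^2$ and it satisfies the equation.
   Context: Polynomials in $z$ are identified with the entire functions they define, so $\mathbb{Z}[z]\subseteq\mathscr{R}$. *)

theory Defs
  imports "HOL-Analysis.Analysis" "HOL-Computational_Algebra.Polynomial"
begin

text \<open>Entire functions are represented as functions on the complex plane, with the pointwise ring
  operations.\<close>

definition exp_poly_ring :: "(complex \<Rightarrow> complex) set"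
  where "exp_poly_ring =
    {f. \<exists>(n::nat) (p :: nat \<Rightarrow> complex poly) (q :: nat \<Rightarrow> complex poly).
          n \<ge> 1 \<and> f = (\<lambda>z. \<Sum>j=1..n. poly (p j) z * exp (poly (q j) z))}"

text \<open>The image of the integer polynomials among the entire functions.\<close>

definition int_poly_functions :: "(complex \<Rightarrow> complex) set"
  where "int_poly_functions = {f. \<exists>p :: int poly. f = (\<lambda>z. poly (map_poly of_int p) z)}"

text \<open>Equality in the ring is equality of functions, hence the quantifier over all points.\<close>

definition pell_solution :: "(complex \<Rightarrow> complex) \<Rightarrow> (complex \<Rightarrow> complex) \<Rightarrow> bool"
  where "pell_solution x y \<longleftrightarrow> (\<forall>z. (x z)\<^sup>2 - (z\<^sup>2 - 1) * (y z)\<^sup>2 = 1)"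

end

theory Submission
  imports Defs
begin

text \<open>Exponentials of polynomials without constant term are linearly independent over the
  polynomials, so elements of the ring multiply like elements of a group ring whose exponent group
  is torsion-free abelian. If \<open>m\<close> is the extremal exponent of a solution, with coefficients \<open>a\<close> and
  \<open>b\<close>, then the coefficient of \<open>exp (2 m)\<close> in \<open>x\<^sup>2 - (z\<^sup>2 - 1) y\<^sup>2\<close> is \<open>a\<^sup>2 - (z\<^sup>2 - 1) b\<^sup>2\<close>, which does not
  vanish because \<open>z\<^sup>2 - 1\<close> is not a square. Hence \<open>m = 0\<close>, and \<open>x\<close> and \<open>y\<close> are polynomials. Dividing
  by the unit \<open>z + sqrt (z\<^sup>2 - 1)\<close>, which has integral coefficients, lowers the degree of \<open>y\<close> until
  only \<open>x = 1\<close> or \<open>x = -1\<close> with \<open>y = 0\<close> remains.\<close>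

section \<open>Linear independence of exponentials over the polynomials\<close>

text \<open>The derivative of \<open>p * exp r\<close> is
  \<open>(pderiv p + p * pderiv r) * exp r\<close>. Differentiation lowers the degree of a
  nonconstant \<open>p\<close>, while multiplication by \<open>pderiv r\<close> cannot, so the two
  summands never cancel for nonzero \<open>p\<close>.\<close>

lemma pderiv_add_mult_eq_0_iff:
  fixes p r :: "complex poly"
  assumes "pderiv r \<noteq> 0"
  shows "pderiv p + p * pderiv r = 0 \<longleftrightarrow> p = 0"
proof
  assume *: "pderiv p + p * pderiv r = 0"
  show "p = 0"
  proof (rule ccontr)
    assume p: "p \<noteq> 0"
    have eq: "pderiv p = - (p * pderiv r)"
      using * by (simp add: eq_neg_iff_add_eq_0)
    then have "degree (pderiv p) = degree p + degree (pderiv r)"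
      using p assms by (simp add: degree_mult_eq)
    moreover have "degree p \<noteq> 0"
      using eq p assms by (simp flip: pderiv_eq_0_iff)
    ultimately show False
      by (simp add: degree_pderiv)
  qed
qed simp

lemma funpow_pderiv_eq_0:
  fixes p :: "complex poly"
  assumes "degree p < k"
  shows "(pderiv ^^ k) p = 0"
  using assms
proof (induction k arbitrary: p)
  case (Suc k)
  show ?case
  proof (cases "degree p = 0")
    case True
    then have "pderiv p = 0"
      by (simp add: pderiv_eq_0_iff)
    moreover have "(pderiv ^^ k) 0 = (0 :: complex poly)"
      by (induction k) simp_all
    ultimately show ?thesis
      by (simp add: funpow_swap1)
  next
    case False
    then have "degree (pderiv p) < k"
      using Suc.prems by (simp add: degree_pderiv)
    then show ?thesis
      using Suc.IH by (simp add: funpow_swap1)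
  qed
qed simp

text \<open>Induction on the number of exponents. Distinct exponents without constant term have a
  nonconstant difference; otherwise \<open>exp q\<close> and \<open>exp (q + c)\<close> would be
  proportional.\<close>

lemma exp_poly_independent:
  fixes P :: "complex poly \<Rightarrow> complex poly"
  assumes "finite S" and "\<And>q. q \<in> S \<Longrightarrow> coeff q 0 = 0"
    and "\<And>z. (\<Sum>q\<in>S. poly (P q) z * exp (poly q z)) = 0"
  shows "\<forall>q\<in>S. P q = 0"
  using assms
proof (induction S arbitrary: P rule: finite_induct)
  case (insert r S)
  define D where "D = (\<lambda>q p. pderiv p + p * pderiv (q - r))"
  \<comment> \<open>Dividing by \<open>exp r\<close> and differentiating often enough removes the term of \<open>r\<close>, while \<open>D q\<close>
    keeps the other coefficients nonzero.\<close>
  have step: "poly ((pderiv ^^ k) (P r)) z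
      + (\<Sum>q\<in>S. poly ((D q ^^ k) (P q)) z * exp (poly (q - r) z)) = 0" for k z
  proof (induction k arbitrary: z)
    case 0
    have "(poly (P r) z + (\<Sum>q\<in>S. poly (P q) z * exp (poly (q - r) z))) * exp (poly r z) = 0"
      using insert.prems(2)[of z] insert.hyps
      by (simp add: distrib_right sum_distrib_right mult.assoc flip: exp_add)
    then show ?case
      by simp
  next
    case (Suc k)
    let ?F = "\<lambda>z. poly ((pderiv ^^ k) (P r)) z
      + (\<Sum>q\<in>S. poly ((D q ^^ k) (P q)) z * exp (poly (q - r) z))"
    have "(?F has_field_derivative
        poly (pderiv ((pderiv ^^ k) (P r))) z
        + (\<Sum>q\<in>S. poly (D q ((D q ^^ k) (P q))) z * exp (poly (q - r) z))) (at z)"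
      by (auto intro!: derivative_eq_intros poly_DERIV sum.cong simp: D_def pderiv_diff algebra_simps)
    moreover have "?F = (\<lambda>_. 0)"
      using Suc.IH by auto
    ultimately show ?case
      using DERIV_unique[OF _ DERIV_const, of 0] by auto
  qed
  \<comment> \<open>This many derivatives annihilate \<open>P r\<close>.\<close>
  define k where "k = Suc (degree (P r))"
  \<comment> \<open>Multiplying by \<open>exp r\<close> restores the exponents in \<open>S\<close>,
    to which the induction hypothesis applies.\<close>
  have "(\<Sum>q\<in>S. poly ((D q ^^ k) (P q)) z * exp (poly q z)) = 0" for z
  proof -
    have "(\<Sum>q\<in>S. poly ((D q ^^ k) (P q)) z * exp (poly (q - r) z)) * exp (poly r z) = 0"
      using step[of k z] funpow_pderiv_eq_0[of "P r" k] by (simp add: k_def)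
    then show ?thesis
      by (simp only: sum_distrib_right mult.assoc flip: exp_add) simp
  qed
  then have "\<forall>q\<in>S. (D q ^^ k) (P q) = 0"
    using insert.IH[of "\<lambda>q. (D q ^^ k) (P q)"] insert.prems(1) by auto
  moreover have "P q = 0" if "q \<in> S" "(D q ^^ m) (P q) = 0" for q m
  proof -
    have "pderiv (q - r) \<noteq> 0"
    proof
      assume "pderiv (q - r) = 0"
      then obtain c where c: "q - r = [:c:]"
        by (metis degree_eq_zeroE pderiv_eq_0_iff)
      have "coeff (q - r) 0 = 0"
        using insert.prems(1) that(1) by simp
      with c have "q = r"
        by simp
      with insert.hyps that(1) show False
        by simp
    qed
    then have inj: "D q p = 0 \<longleftrightarrow> p = 0" for p
      unfolding D_def by (rule pderiv_add_mult_eq_0_iff)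
    from that(2) show ?thesis
      by (induction m) (simp_all add: inj)
  qed
  ultimately have S: "\<forall>q\<in>S. P q = 0"
    by blast
  then have "poly (P r) z = 0" for z
    using insert.prems(2)[of z] insert.hyps by simp
  then have "P r = 0"
    using poly_all_0_iff_0 by blast
  with S show ?case
    by simp
qed simp

section \<open>Collecting equal exponents and comparing coefficients\<close>

lemma sum_exp_poly_group:
  fixes F g :: "'i \<Rightarrow> complex poly"
  assumes "finite I" "finite T" "g ` I \<subseteq> T"
  shows "(\<Sum>i\<in>I. poly (F i) z * exp (poly (g i) z))
       = (\<Sum>q\<in>T. poly (\<Sum>i\<in>{i\<in>I. g i = q}. F i) z * exp (poly q z))"
proof -
  have "(\<Sum>i\<in>I. poly (F i) z * exp (poly (g i) z))
      = (\<Sum>q\<in>T. \<Sum>i\<in>{i\<in>I. g i = q}. poly (F i) z * exp (poly (g i) z))"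
    by (rule sum.group[OF assms, symmetric])
  also have "\<dots> = (\<Sum>q\<in>T. poly (\<Sum>i\<in>{i\<in>I. g i = q}. F i) z * exp (poly q z))"
    by (intro sum.cong refl) (simp add: poly_sum sum_distrib_right)
  finally show ?thesis .
qed

lemma exp_poly_coeff_eq_0:
  fixes F g :: "'i \<Rightarrow> complex poly"
  assumes I: "finite I" and g: "\<And>i. i \<in> I \<Longrightarrow> coeff (g i) 0 = 0"
    and eq: "\<And>z. (\<Sum>i\<in>I. poly (F i) z * exp (poly (g i) z)) = poly c z"
    and "q \<noteq> 0"
  shows "(\<Sum>i\<in>{i\<in>I. g i = q}. F i) = 0"
proof (cases "q \<in> g ` I")
  case True
  \<comment> \<open>The exponent 0 is added because the polynomial \<open>c\<close> is moved into
    its coefficient.\<close>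
  define T where "T = insert 0 (g ` I)"
  define P where "P = (\<lambda>q. (\<Sum>i\<in>{i\<in>I. g i = q}. F i) - (if q = 0 then c else 0))"
  have T: "finite T" "g ` I \<subseteq> T" "0 \<in> T"
    using I by (auto simp: T_def)
  have "(\<Sum>q\<in>T. poly (P q) z * exp (poly q z)) = 0" for z
  proof -
    have "(\<Sum>q\<in>T. poly (P q) z * exp (poly q z))
        = (\<Sum>q\<in>T. poly (\<Sum>i\<in>{i\<in>I. g i = q}. F i) z * exp (poly q z))
          - (\<Sum>q\<in>T. if q = 0 then poly c z else 0)"
      unfolding sum_subtractf[symmetric]
      by (intro sum.cong) (auto simp: P_def algebra_simps)
    also have "\<dots> = 0"
      using T eq sum_exp_poly_group[OF I T(1,2), of F z] by simp
    finally show ?thesis .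
  qed
  moreover have "coeff q 0 = 0" if "q \<in> T" for q
    using that g by (auto simp: T_def)
  ultimately have "\<forall>q\<in>T. P q = 0"
    using exp_poly_independent[OF T(1)] by blast
  then have "P q = 0"
    using True T(2) by blast
  with \<open>q \<noteq> 0\<close> show ?thesis
    by (simp add: P_def)
next
  case False
  then have "{i\<in>I. g i = q} = {}"
    by auto
  then show ?thesis
    by (simp only: sum.empty)
qed

text \<open>The constant term of an exponent becomes a scalar factor of its coefficient. The freedom
  in \<open>T\<close> allows two functions to be expanded over a common set of exponents.\<close>

lemma exp_poly_ring_normal_form:
  assumes "f \<in> exp_poly_ring"
  shows "\<exists>S P. finite S \<and> (\<forall>q\<in>S. coeff q 0 = 0) \<and>
    (\<forall>T z. finite T \<longrightarrow> S \<subseteq> T \<longrightarrow> f z = (\<Sum>q\<in>T. poly (P q) z * exp (poly q z)))"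
proof -
  obtain n p q where f: "f = (\<lambda>z. \<Sum>j=1..n::nat. poly (p j) z * exp (poly (q j) z))"
    using assms unfolding exp_poly_ring_def by blast
  define g where "g = (\<lambda>j. q j - [:coeff (q j) 0:])"
  define F where "F = (\<lambda>j. smult (exp (coeff (q j) 0)) (p j))"
  define P where "P = (\<lambda>q. \<Sum>j\<in>{j\<in>{1..n}. g j = q}. F j)"
  have f': "f z = (\<Sum>j=1..n. poly (F j) z * exp (poly (g j) z))" for z
    unfolding f by (intro sum.cong) (auto simp: F_def g_def exp_diff)
  have "f z = (\<Sum>q\<in>T. poly (P q) z * exp (poly q z))"
    if "finite T" "g ` {1..n} \<subseteq> T" for T z
    unfolding f' P_def by (rule sum_exp_poly_group) (use that in auto)
  moreover have "\<forall>q\<in>g ` {1..n}. coeff q 0 = 0"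
    by (auto simp: g_def)
  moreover have "finite (g ` {1..n})"
    by simp
  ultimately show ?thesis
    by (intro exI[of _ "g ` {1..n}"] exI[of _ P]) blast
qed

section \<open>Extremal exponents of a solution\<close>

text \<open>Such an \<open>L\<close> orders the exponents in \<open>S\<close> compatibly with
  addition, which gives a meaning to extremal exponents.\<close>

lemma finite_set_separating_additive:
  fixes S :: "complex poly set"
  assumes "finite S"
  obtains L :: "complex poly \<Rightarrow> real" where "\<And>p q. L (p + q) = L p + L q" "inj_on L S"
proof -
  define D where "D = (\<lambda>(p, q). p - q) ` (S \<times> S) - {0}"
  have D: "finite D" "0 \<notin> D"
    using assms by (auto simp: D_def)
  \<comment> \<open>A generic real functional of the value at a generic point works.\<close>
  have "finite (\<Union>d\<in>D. {t. poly d t = 0})"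
    using D by (auto intro!: poly_roots_finite)
  from ex_new_if_finite[OF infinite_UNIV_char_0 this]
  obtain t where t: "\<And>d. d \<in> D \<Longrightarrow> poly d t \<noteq> 0"
    by auto
  \<comment> \<open>These are the slopes \<open>s\<close> at which \<open>L\<close> could vanish on
    \<open>D\<close>. If \<open>Im (poly d t) = 0\<close>, the quotient is 0 by convention, and
    \<open>L d\<close> is the real part of a nonzero real value.\<close>
  have "finite ((\<lambda>d. - Re (poly d t) / Im (poly d t)) ` D)"
    using D by simp
  from ex_new_if_finite[OF infinite_UNIV_char_0 this]
  obtain s where s: "s \<notin> (\<lambda>d. - Re (poly d t) / Im (poly d t)) ` D"
    by auto
  define L where "L = (\<lambda>p. Re (poly p t) + s * Im (poly p t))"
  have L: "L d \<noteq> 0" if "d \<in> D" for d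
  proof
    assume *: "L d = 0"
    show False
    proof (cases "Im (poly d t) = 0")
      case True
      with * have "poly d t = 0"
        by (simp add: L_def complex_eq_iff)
      with t that show False
        by blast
    next
      case False
      with * have "s = - Re (poly d t) / Im (poly d t)"
        by (simp add: L_def field_simps)
      with s that show False
        by blast
    qed
  qed
  show thesis
  proof
    show "L (p + q) = L p + L q" for p q
      by (simp add: L_def algebra_simps)
    show "inj_on L S"
    proof (rule inj_onI, rule ccontr)
      fix p q
      assume *: "p \<in> S" "q \<in> S" "L p = L q" "p \<noteq> q"
      then have "p - q \<in> D"
        by (force simp: D_def)
      moreover have "L (p - q) = 0"
        using * by (simp add: L_def algebra_simps)
      ultimately show False
        using L by blast
    qed
  qed
qed

text \<open>Parity of the order of vanishing at 1: it is even for \<open>A * A\<close>, but odd for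
  the other term, because \<open>z^2 - 1\<close> has a simple zero there.\<close>

lemma pell_form_eq_0:
  fixes A B :: "complex poly"
  assumes "A\<^sup>2 - [:-1, 0, 1:] * B\<^sup>2 = 0"
  shows "A = 0 \<and> B = 0"
proof (rule ccontr)
  assume nz: "\<not> (A = 0 \<and> B = 0)"
  have fac: "[:-1, 0, 1:] = [:-1, 1:] * [:1, 1 :: complex:]"
    by simp
  have eq: "A * A = [:-1, 1:] * ([:1, 1:] * (B * B))"
    using assms unfolding fac by (simp add: power2_eq_square mult.assoc)
  have B: "B \<noteq> 0"
    using nz eq by auto
  have A: "A \<noteq> 0"
  proof
    assume "A = 0"
    then have "[:-1, 1:] * ([:1, 1:] * (B * B)) = 0"
      using eq by simp
    with B show False
      by (simp only: mult_eq_0_iff) simp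
  qed
  have nz': "[:-1, 1:] * ([:1, 1:] * (B * B)) \<noteq> 0" "[:1, 1:] * (B * B) \<noteq> 0" "B * B \<noteq> 0"
    using B by (simp_all only: mult_eq_0_iff) simp_all
  have "order 1 [:-1, 1 :: complex:] = 1"
    using order_power_n_n[of "1::complex" 1] by simp
  moreover have "order 1 [:1, 1 :: complex:] = 0"
    by (simp add: order_0I)
  moreover have "order 1 A + order 1 A = order 1 ([:-1, 1:] * ([:1, 1:] * (B * B)))"
    unfolding eq[symmetric] using A by (simp add: order_mult)
  ultimately have "order 1 A + order 1 A = 1 + (order 1 B + order 1 B)"
    unfolding order_mult[OF nz'(1)] order_mult[OF nz'(2)] order_mult[OF nz'(3)] by simp
  then show False
    by presburger
qed

lemma pell_max_exponent:
  fixes L :: "complex poly \<Rightarrow> real"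
  assumes S: "finite S" and S0: "\<And>q. q \<in> S \<Longrightarrow> coeff q 0 = 0"
    and AB: "\<And>q. q \<in> S \<Longrightarrow> A q \<noteq> 0 \<or> B q \<noteq> 0"
    and x: "\<And>z. x z = (\<Sum>q\<in>S. poly (A q) z * exp (poly q z))"
    and y: "\<And>z. y z = (\<Sum>q\<in>S. poly (B q) z * exp (poly q z))"
    and pell: "pell_solution x y"
    and L: "\<And>p q. L (p + q) = L p + L q" "inj_on L S"
    and m: "m \<in> S" "\<And>q. q \<in> S \<Longrightarrow> L q \<le> L m"
  shows "m = 0"
proof (rule ccontr)
  assume "m \<noteq> 0"
  define F where "F = (\<lambda>(p, q). A p * A q - [:-1, 0, 1:] * (B p * B q))"
  have "(\<Sum>i\<in>S\<times>S. poly (F i) z * exp (poly (fst i + snd i) z)) = poly 1 z" for z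
  proof -
    have "(\<Sum>i\<in>S\<times>S. poly (F i) z * exp (poly (fst i + snd i) z))
        = (\<Sum>p\<in>S. \<Sum>q\<in>S. (poly (A p) z * exp (poly p z)) * (poly (A q) z * exp (poly q z))
           - (z\<^sup>2 - 1) * ((poly (B p) z * exp (poly p z)) * (poly (B q) z * exp (poly q z))))"
      by (subst sum.cartesian_product)
        (auto intro!: sum.cong simp: F_def exp_add algebra_simps power2_eq_square)
    also have "\<dots> = (x z)\<^sup>2 - (z\<^sup>2 - 1) * (y z)\<^sup>2"
      unfolding x y power2_eq_square[of "sum _ _"] sum_product
      by (simp add: sum_subtractf sum_distrib_left)
    also have "\<dots> = poly 1 z"
      using pell by (simp add: pell_solution_def)
    finally show ?thesis .
  qed
  then have "(\<Sum>i\<in>{i\<in>S\<times>S. fst i + snd i = m + m}. F i) = 0"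
  proof (rule exp_poly_coeff_eq_0[rotated 2])
    have "m + m = smult 2 m"
      by (metis one_add_one smult_1_left smult_add_left)
    with \<open>m \<noteq> 0\<close> show "m + m \<noteq> 0"
      by simp
  qed (use S S0 in auto)
  moreover have "{i\<in>S\<times>S. fst i + snd i = m + m} = {(m, m)}"
  proof -
    \<comment> \<open>Neither \<open>L p\<close> nor \<open>L q\<close> exceeds \<open>L m\<close>,
      so their sum reaches \<open>L m + L m\<close> only if both equal \<open>L m\<close>;
      injectivity then identifies the exponents.\<close>
    have "p = m \<and> q = m" if "p \<in> S" "q \<in> S" "p + q = m + m" for p q
    proof -
      have "L p + L q = L m + L m"
        using that(3) L(1) by metis
      with m(2)[of p] m(2)[of q] that have "L p = L m" "L q = L m"
        by simp_all
      with L(2) that m(1) show ?thesis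
        by (auto dest: inj_onD)
    qed
    with m(1) show ?thesis
      by auto
  qed
  ultimately have "(A m)\<^sup>2 - [:-1, 0, 1:] * (B m)\<^sup>2 = 0"
    by (simp add: F_def power2_eq_square)
  with pell_form_eq_0 AB m(1) show False
    by blast
qed

lemma pell_solution_exp_poly_imp_poly:
  assumes "x \<in> exp_poly_ring" "y \<in> exp_poly_ring" and pell: "pell_solution x y"
  obtains A B :: "complex poly" where "x = poly A" "y = poly B"
proof -
  obtain Sx A where A: "finite Sx" "\<forall>q\<in>Sx. coeff q 0 = 0"
    "\<forall>T z. finite T \<longrightarrow> Sx \<subseteq> T \<longrightarrow> x z = (\<Sum>q\<in>T. poly (A q) z * exp (poly q z))"
    using exp_poly_ring_normal_form[OF assms(1)] by (elim exE conjE) (rule that)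
  obtain Sy B where B: "finite Sy" "\<forall>q\<in>Sy. coeff q 0 = 0"
    "\<forall>T z. finite T \<longrightarrow> Sy \<subseteq> T \<longrightarrow> y z = (\<Sum>q\<in>T. poly (B q) z * exp (poly q z))"
    using exp_poly_ring_normal_form[OF assms(2)] by (elim exE conjE) (rule that)
  \<comment> \<open>Discarding exponents where both coefficients vanish ensures that the pair of
    coefficients at an extremal exponent is nonzero.\<close>
  define S where "S = {q \<in> Sx \<union> Sy. A q \<noteq> 0 \<or> B q \<noteq> 0}"
  have S: "finite S" "\<And>q. q \<in> S \<Longrightarrow> coeff q 0 = 0" "\<And>q. q \<in> S \<Longrightarrow> A q \<noteq> 0 \<or> B q \<noteq> 0"
    using A(1,2) B(1,2) by (auto simp: S_def)
  have x: "x z = (\<Sum>q\<in>S. poly (A q) z * exp (poly q z))" for z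
    unfolding A(3)[rule_format, OF finite_UnI[OF A(1) B(1)] Un_upper1]
    using A(1) B(1) by (intro sum.mono_neutral_right) (auto simp: S_def)
  have y: "y z = (\<Sum>q\<in>S. poly (B q) z * exp (poly q z))" for z
    unfolding B(3)[rule_format, OF finite_UnI[OF A(1) B(1)] Un_upper2]
    using A(1) B(1) by (intro sum.mono_neutral_right) (auto simp: S_def)
  obtain L :: "complex poly \<Rightarrow> real" where L: "\<And>p q. L (p + q) = L p + L q" "inj_on L S"
    using finite_set_separating_additive[OF S(1)] by blast
  have "S \<subseteq> {0}"
  proof
    fix q assume q: "q \<in> S"
    \<comment> \<open>Applied to both \<open>L\<close> and \<open>- L\<close>, this shows that 0 is
      the largest and the smallest exponent, hence the only one.\<close>
    have extreme: "K q \<le> K 0 \<and> 0 \<in> S"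
      if K: "\<And>p q. K (p + q) = K p + K q" "inj_on K S" for K :: "complex poly \<Rightarrow> real"
    proof -
      have "Max (K ` S) \<in> K ` S"
        using S(1) q by (intro Max_in) auto
      then obtain m where m: "m \<in> S" "Max (K ` S) = K m"
        by auto
      have max: "K r \<le> K m" if "r \<in> S" for r
        using that S(1) m(2) Max_ge[of "K ` S" "K r"] by simp
      with pell_max_exponent[OF S x y pell K m(1)] have "m = 0"
        by blast
      with max q m(1) show ?thesis
        by simp
    qed
    have "L q \<le> L 0" "0 \<in> S"
      using extreme[OF L] by auto
    moreover have "- L q \<le> - L 0"
      using extreme[of "\<lambda>p. - L p"] L by (simp add: inj_on_def)
    ultimately have "L q = L 0"
      by linarith
    with inj_onD[OF L(2) _ q \<open>0 \<in> S\<close>] show "q \<in> {0}"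
      by blast
  qed
  then consider "S = {}" | "S = {0}"
    by blast
  then show thesis
  proof cases
    case 1
    then have "x = poly 0" "y = poly 0"
      by (auto simp: x y)
    then show ?thesis
      by (rule that)
  next
    case 2
    then have "x = poly (A 0)" "y = poly (B 0)"
      by (auto simp: x y)
    then show ?thesis
      by (rule that)
  qed
qed

section \<open>Polynomial solutions\<close>

text \<open>The constant 1 has too small a degree to affect the leading term, so \<open>A^2\<close>
  and \<open>(z^2 - 1) * B^2\<close> have the same one.\<close>

lemma poly_pell_degree:
  fixes A B :: "complex poly"
  assumes pell: "A\<^sup>2 - [:-1, 0, 1:] * B\<^sup>2 = 1" and "B \<noteq> 0"
  shows "degree A = Suc (degree B) \<and> (lead_coeff A)\<^sup>2 = (lead_coeff B)\<^sup>2"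
proof -
  have eq: "A\<^sup>2 = [:-1, 0, 1:] * B\<^sup>2 + 1"
    using pell by (simp add: algebra_simps)
  have nz: "[:-1, 0, 1 :: complex:] \<noteq> 0" "B\<^sup>2 \<noteq> 0"
    using \<open>B \<noteq> 0\<close> by simp_all
  have d: "degree ([:-1, 0, 1:] * B\<^sup>2) = 2 + 2 * degree B"
    using degree_mult_eq[OF nz] by (simp add: degree_power_eq \<open>B \<noteq> 0\<close>)
  then have d1: "degree (1 :: complex poly) < degree ([:-1, 0, 1:] * B\<^sup>2)"
    by simp
  have "degree (A\<^sup>2) = 2 + 2 * degree B"
    unfolding eq degree_add_eq_left[OF d1] d ..
  then have "degree A = Suc (degree B)"
    by (cases "A = 0") (simp_all add: degree_power_eq)
  moreover have "lead_coeff (A\<^sup>2) = lead_coeff ([:-1, 0, 1:] * B\<^sup>2)"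
    unfolding eq degree_add_eq_left[OF d1] using d by (simp add: coeff_eq_0)
  then have "(lead_coeff A)\<^sup>2 = (lead_coeff B)\<^sup>2"
    unfolding lead_coeff_mult lead_coeff_power by simp
  ultimately show ?thesis
    by simp
qed

text \<open>The product of \<open>z * B - A\<close> and \<open>z * B + A\<close> is
  \<open>B^2 - 1\<close>, of degree at most \<open>2 * degree B\<close>. Equal leading coefficients
  prevent cancellation in the second factor, so it takes up at least \<open>degree B + 1\<close> of
  this. The solution \<open>A = z\<close>, \<open>B = 1\<close> shows why a zero difference is
  treated separately.\<close>

lemma poly_pell_descent:
  fixes A B :: "complex poly"
  assumes pell: "A\<^sup>2 - [:-1, 0, 1:] * B\<^sup>2 = 1" and "B \<noteq> 0"
    and lead: "lead_coeff A = lead_coeff B"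
    and nz: "[:0, 1:] * B - A \<noteq> 0"
  shows "degree ([:0, 1:] * B - A) < degree B"
proof -
  let ?z = "[:0, 1 :: complex:]"
  have dA: "degree A = Suc (degree B)"
    using poly_pell_degree[OF assms(1,2)] by simp
  have "coeff (?z * B + A) (Suc (degree B)) = 2 * lead_coeff B"
    using lead dA by simp
  then have c: "coeff (?z * B + A) (Suc (degree B)) \<noteq> 0"
    using \<open>B \<noteq> 0\<close> by simp
  then have ge: "Suc (degree B) \<le> degree (?z * B + A)"
    by (rule le_degree)
  have nz': "?z * B + A \<noteq> 0"
    using c by (metis coeff_0)
  have d: "[:-1, 0, 1:] = ?z * ?z - 1"
    by (simp add: one_pCons)
  have "(?z * B - A) * (?z * B + A) = B\<^sup>2 - 1"
    using pell unfolding d by algebra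
  then have "degree (?z * B - A) + degree (?z * B + A) = degree (B\<^sup>2 - 1)"
    using degree_mult_eq[OF nz nz'] by simp
  also have "\<dots> \<le> 2 * degree B"
    by (rule degree_diff_le) (simp_all add: degree_power_le degree_power_eq \<open>B \<noteq> 0\<close>)
  finally show ?thesis
    using ge by simp
qed

lemma Ints_coeff_mult:
  fixes p q :: "'a :: comm_ring_1 poly"
  assumes "\<And>n. coeff p n \<in> \<int>" "\<And>n. coeff q n \<in> \<int>"
  shows "coeff (p * q) n \<in> \<int>"
  using assms by (auto simp: coeff_mult intro!: Ints_sum Ints_mult)

lemma poly_pell_integral:
  fixes A B :: "complex poly"
  assumes "A\<^sup>2 - [:-1, 0, 1:] * B\<^sup>2 = 1"
  shows "(\<forall>n. coeff A n \<in> \<int>) \<and> (\<forall>n. coeff B n \<in> \<int>)"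
  using assms
\<comment> \<open>The shift by one makes the passage from a nonzero constant \<open>B\<close> to 0
  count as a descent.\<close>
proof (induction "if B = 0 then 0 else Suc (degree B)" arbitrary: A B rule: less_induct)
  case less
  let ?z = "[:0, 1 :: complex:]" and ?d = "[:-1, 0, 1 :: complex:]"
  have d: "?d = ?z * ?z - 1"
    by (simp add: one_pCons)
  show ?case
  proof (cases "B = 0")
    case True
    with less.prems have "A = 1 \<or> A = - 1"
      by (simp add: power2_eq_1_iff)
    with True show ?thesis
      by (auto simp: coeff_1)
  next
    case False
    \<comment> \<open>Multiplication by the inverse of the fundamental unit \<open>z + sqrt (z\<^sup>2 - 1)\<close>.\<close>
    have descend: "(\<forall>n. coeff A n \<in> \<int>) \<and> (\<forall>n. coeff C n \<in> \<int>)"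
      if C: "C \<noteq> 0" "degree C = degree B" "lead_coeff A = lead_coeff C"
        and pell: "A\<^sup>2 - ?d * C\<^sup>2 = 1" for C
    proof -
      define A' where "A' = ?z * A - ?d * C"
      define B' where "B' = ?z * C - A"
      have "A'\<^sup>2 - ?d * B'\<^sup>2 = 1"
        using pell unfolding A'_def B'_def d by algebra
      moreover have "(if B' = 0 then 0 else Suc (degree B')) < (if B = 0 then 0 else Suc (degree B))"
        using poly_pell_descent[OF pell C(1,3)] False C(2) by (simp add: B'_def)
      ultimately have int: "\<And>n. coeff A' n \<in> \<int>" "\<And>n. coeff B' n \<in> \<int>"
        using less.hyps by blast+
      have coeffs: "coeff ?z n \<in> \<int>" "coeff ?d n \<in> \<int>" for n
        by (auto simp: coeff_pCons split: nat.split)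
      \<comment> \<open>Multiplying back by the fundamental unit involves only integral
        coefficients, so integrality passes from the smaller solution to \<open>A\<close> and
        \<open>C\<close>.\<close>
      have "A = ?z * A' + ?d * B'" "C = A' + ?z * B'"
        unfolding A'_def B'_def d by algebra+
      then show ?thesis
        by (metis (no_types, lifting) int coeffs Ints_coeff_mult Ints_add coeff_add)
    qed
    \<comment> \<open>The sign decides whether \<open>descend\<close> is used with \<open>B\<close>
      or \<open>- B\<close>; both give the same equation, and integrality is insensitive to the
      sign.\<close>
    have "lead_coeff A = lead_coeff B \<or> lead_coeff A = - lead_coeff B"
      using poly_pell_degree[OF less.prems False] unfolding power2_eq_iff by (rule conjunct2)
    then show ?thesis
    proof
      assume "lead_coeff A = lead_coeff B"
      with descend[of B] False less.prems show ?thesis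
        by blast
    next
      assume "lead_coeff A = - lead_coeff B"
      with descend[of "- B"] False less.prems show ?thesis
        by simp
    qed
  qed
qed

section \<open>From polynomials to the functions they define\<close>

lemma poly_in_int_poly_functions:
  assumes "\<forall>n. coeff A n \<in> \<int>"
  shows "poly A \<in> int_poly_functions"
proof -
  from assms obtain p where "A = map_poly of_int p"
    using intpolyE by metis
  then show ?thesis
    unfolding int_poly_functions_def by blast
qed

lemma int_poly_functions_subset: "int_poly_functions \<subseteq> exp_poly_ring"
proof
  fix f assume "f \<in> int_poly_functions"
  then obtain p :: "int poly" where f: "f = (\<lambda>z. poly (map_poly of_int p) z)"
    unfolding int_poly_functions_def by blast
  show "f \<in> exp_poly_ring"
    unfolding exp_poly_ring_def f
    by (intro CollectI exI[of _ "1::nat"] exI[of _ "\<lambda>_. map_poly of_int p"] exI[of _ "\<lambda>_. 0"]) simp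
qed

theorem theorem1p3:
  fixes x y :: "complex \<Rightarrow> complex"
  shows "(x \<in> exp_poly_ring \<and> y \<in> exp_poly_ring \<and> pell_solution x y) \<longleftrightarrow>
         (x \<in> int_poly_functions \<and> y \<in> int_poly_functions \<and> pell_solution x y)"
proof
  assume *: "x \<in> exp_poly_ring \<and> y \<in> exp_poly_ring \<and> pell_solution x y"
  then obtain A B where AB: "x = poly A" "y = poly B"
    using pell_solution_exp_poly_imp_poly by metis
  \<comment> \<open>Agreement at all complex points turns the functional equation into an identity
    of polynomials.\<close>
  have "poly (A\<^sup>2 - [:-1, 0, 1:] * B\<^sup>2) z = poly 1 z" for z
    using * by (simp add: AB pell_solution_def power2_eq_square algebra_simps)
  then have "A\<^sup>2 - [:-1, 0, 1:] * B\<^sup>2 = 1"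
    by (simp add: poly_eq_poly_eq_iff[symmetric] fun_eq_iff)
  with * AB show "x \<in> int_poly_functions \<and> y \<in> int_poly_functions \<and> pell_solution x y"
    using poly_pell_integral poly_in_int_poly_functions by blast
qed (use int_poly_functions_subset in blast)

end
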